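(* There exists $n_0$ such that the following holds for every even integer $n \ge n_0$. If $\mathcal{F}$ is a maximal $3$-wise intersecting family of subsets of $[n]=\{1,\ldots,n\}$ with $|\mathcal{F}| \le 2^{(n+2)/2}-3$, then $\mathcal{F}$ is a balanced pair of linked cubes.
   Context: A family $\mathcal{F}$ of subsets of $[n]$ is $k$-wise intersecting if every collection of at most $k$ members of $\mathcal{F}$ has a common element; it is maximal $k$-wise intersecting if moreover no subset of $[n]$ outside $\mathcal{F}$ can be added to $\mathcal{F}$ while preserving this property. A pair of linked cubes is a family of the form $\{A : S \subsetneq A \subseteq [n]\} \cup \{B : [n]\setminus S \subsetneq B \subseteq [n]\}$ for some $S \subseteq [n]$; it is balanced if $\lfloor n/2\rfloor \le |S| \le \lceil n/2 \rceil$. *)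

theory Defs
  imports Complex_Main
begin

definition ground :: "nat \<Rightarrow> nat set" where
  "ground n = {1..n}"

definition k_wise_intersecting :: "nat \<Rightarrow> nat set set \<Rightarrow> bool" where
  "k_wise_intersecting k F \<longleftrightarrow>
     (\<forall>G. G \<subseteq> F \<and> G \<noteq> {} \<and> card G \<le> k \<longrightarrow> \<Inter>G \<noteq> {})"

definition maximal_k_wise_intersecting :: "nat \<Rightarrow> nat \<Rightarrow> nat set set \<Rightarrow> bool" where
  "maximal_k_wise_intersecting n k F \<longleftrightarrow>
     F \<subseteq> Pow (ground n) \<and> k_wise_intersecting k F \<and>
     (\<forall>A. A \<subseteq> ground n \<and> A \<notin> F \<longrightarrow> \<not> k_wise_intersecting k (insert A F))"

definition linked_cubes :: "nat \<Rightarrow> nat set \<Rightarrow> nat set set" where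
  "linked_cubes n S =
     {A. S \<subset> A \<and> A \<subseteq> ground n} \<union> {B. ground n - S \<subset> B \<and> B \<subseteq> ground n}"

definition balanced_linked_cubes :: "nat \<Rightarrow> nat set set \<Rightarrow> bool" where
  "balanced_linked_cubes n F \<longleftrightarrow>
     (\<exists>S. S \<subseteq> ground n \<and> n div 2 \<le> card S \<and> card S \<le> (n + 1) div 2 \<and>
          F = linked_cubes n S)"

end

theory Submission
  imports Defs "HOL-Library.FuncSet" "HOL-Real_Asymp.Real_Asymp"
begin

text \<open>
  Pass to the family \<open>G\<close> of complements. Maximality of \<open>F\<close> says that \<open>G\<close> is a downset and that a set
  is a union of two members of \<open>G\<close> iff its complement is not in \<open>G\<close>. With \<open>n = 2 k\<close> and
  \<open>|G| \<le> 2 * 2 ^ k - 3\<close>, this forces at least half of the ordered pairs of members of \<open>G\<close> to be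
  disjoint. On the other hand a family of this size has a vanishing proportion of pairwise disjoint
  triples (an argument of Alon and Frankl: the union of a bounded number of random members has size
  nearly \<open>k\<close>, leaving too little room for a disjoint pair). So the disjointness graph is a
  near-extremal graph with few triangles, hence almost complete bipartite, and the union \<open>S\<close> of the
  typical members of one part is such that \<open>G\<close> contains almost all subsets of \<open>S\<close> and of \<open>V - S\<close>,
  with \<open>|S| = k\<close>. A second count then removes the error terms.
\<close>

section \<open>Counting disjoint pairs and triples in a family of sets\<close>

text \<open>Each point of \<open>W\<close> has three options: in \<open>A\<close>, in
  \<open>B\<close>, or in neither. The labelling by 0, 1, 2 records them and determines the
  pair.\<close>

lemma card_disjoint_pairs_le:
  assumes "finite W"
  shows "card {(A, B). A \<subseteq> W \<and> B \<subseteq> W \<and> A \<inter> B = {}} \<le> 3 ^ card W"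
proof -
  let ?E = "{(A, B). A \<subseteq> W \<and> B \<subseteq> W \<and> A \<inter> B = {}}"
  let ?f = "\<lambda>(A, B). \<lambda>x\<in>W. if x \<in> A then 0 else if x \<in> B then 1 else (2::nat)"
  have "inj_on ?f ?E"
  proof (rule inj_onI, clarify)
    fix A B A' B'
    assume sub: "A \<subseteq> W" "B \<subseteq> W" "A \<inter> B = {}" "A' \<subseteq> W" "B' \<subseteq> W" "A' \<inter> B' = {}"
      and eq: "(\<lambda>x\<in>W. if x \<in> A then 0 else if x \<in> B then 1 else (2::nat)) =
        (\<lambda>x\<in>W. if x \<in> A' then 0 else if x \<in> B' then 1 else 2)"
    have "(x \<in> A \<longleftrightarrow> x \<in> A') \<and> (x \<in> B \<longleftrightarrow> x \<in> B')" if "x \<in> W" for x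
      using fun_cong[OF eq, of x] that sub by (auto split: if_splits)
    then show "A = A' \<and> B = B'" using sub by blast
  qed
  moreover have "?f ` ?E \<subseteq> W \<rightarrow>\<^sub>E {0, 1, 2}" by (auto split: if_splits)
  moreover have "finite (W \<rightarrow>\<^sub>E {0, 1, 2::nat})" using assms by (intro finite_PiE) auto
  ultimately have "card ?E \<le> card (W \<rightarrow>\<^sub>E {0, 1, 2::nat})"
    by (meson card_inj_on_le)
  also have "\<dots> = 3 ^ card W" using assms by (simp add: card_PiE numeral_3_eq_3)
  finally show ?thesis .
qed

text \<open>There are at most \<open>2 ^ card V\<close> choices for the union \<open>W\<close>, and
  once it is fixed each of the \<open>t\<close> entries is one of at most \<open>2 ^ u\<close>
  subsets of \<open>W\<close>.\<close>

lemma card_tuples_small_union_le: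
  assumes "finite V" "G \<subseteq> Pow V"
  shows "card {xs. set xs \<subseteq> G \<and> length xs = t \<and> card (\<Union>(set xs)) \<le> u}
    \<le> 2 ^ (card V + u * t)"
proof -
  let ?L = "\<lambda>W. {xs. set xs \<subseteq> Pow W \<and> length xs = t}"
  let ?I = "{W. W \<subseteq> V \<and> card W \<le> u}"
  have fI: "finite ?I" using assms(1) by simp
  have fW: "finite W" if "W \<in> ?I" for W using that assms(1) finite_subset by blast
  have "{xs. set xs \<subseteq> G \<and> length xs = t \<and> card (\<Union>(set xs)) \<le> u} \<subseteq> (\<Union>W\<in>?I. ?L W)"
  proof
    fix xs assume "xs \<in> {xs. set xs \<subseteq> G \<and> length xs = t \<and> card (\<Union>(set xs)) \<le> u}"
    then have "\<Union>(set xs) \<in> ?I" "xs \<in> ?L (\<Union>(set xs))" using assms(2) by auto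
    then show "xs \<in> (\<Union>W\<in>?I. ?L W)" by blast
  qed
  moreover have "finite (\<Union>W\<in>?I. ?L W)"
    by (intro finite_UN_I[OF fI] finite_lists_length_eq finite_Pow_iff[THEN iffD2] fW)
  ultimately have "card {xs. set xs \<subseteq> G \<and> length xs = t \<and> card (\<Union>(set xs)) \<le> u}
      \<le> card (\<Union>W\<in>?I. ?L W)" by (rule card_mono[rotated])
  also have "\<dots> \<le> (\<Sum>W\<in>?I. card (?L W))" by (rule card_UN_le[OF fI])
  also have "\<dots> \<le> (\<Sum>W\<in>?I. 2 ^ (u * t))"
  proof (rule sum_mono)
    fix W assume W: "W \<in> ?I"
    have "card (?L W) = (2 ^ card W) ^ t"
      using fW[OF W] by (simp add: card_lists_length_eq card_Pow)
    also have "\<dots> \<le> (2 ^ u) ^ t" using W by (intro power_mono power_increasing) auto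
    finally show "card (?L W) \<le> 2 ^ (u * t)" by (simp add: power_mult)
  qed
  also have "\<dots> = card ?I * 2 ^ (u * t)" by simp
  also have "\<dots> \<le> 2 ^ card V * 2 ^ (u * t)"
  proof (rule mult_right_mono)
    have "card ?I \<le> card (Pow V)" using assms(1) by (intro card_mono) auto
    then show "card ?I \<le> 2 ^ card V" using assms(1) by (simp add: card_Pow)
  qed simp
  finally show ?thesis by (simp add: power_add)
qed

text \<open>Counts the tuples consisting of two disjoint sets and \<open>t\<close> further sets avoiding both. The
  union of the last \<open>t\<close> sets is rarely small, and when it is large there is little room for the
  first two.\<close>

lemma sum_codegree_power_le:
  fixes G :: "'a set set"
  assumes fin: "finite V" and G: "G \<subseteq> Pow V"
  defines "d \<equiv> \<lambda>C. card {B \<in> G. C \<inter> B = {}}"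
  shows "(\<Sum>(A, B)\<in>{(A, B). A \<in> G \<and> B \<in> G \<and> A \<inter> B = {}}. d (A \<union> B) ^ t)
    \<le> 2 ^ (card V + u * t) * card G ^ 2 + card G ^ t * 3 ^ (card V - u)"
proof -
  let ?E = "{(A, B). A \<in> G \<and> B \<in> G \<and> A \<inter> B = {}}"
  let ?X = "{xs. set xs \<subseteq> G \<and> length xs = t}"
  let ?R = "\<lambda>p xs. (fst p \<union> snd p) \<inter> \<Union>(set xs) = {}"
  let ?S = "{xs. set xs \<subseteq> G \<and> length xs = t \<and> card (\<Union>(set xs)) \<le> u}"
  have fG: "finite G" using fin G finite_subset by blast
  have fE: "finite ?E"
    by (rule finite_subset[of _ "G \<times> G"]) (use fG in auto)
  have fX: "finite ?X" by (rule finite_lists_length_eq[OF fG])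
  \<comment> \<open>A power of the codegree counts \<open>t\<close>-tuples whose entries all avoid
    \<open>A \<union> B\<close>, so the sum can be evaluated tuple by tuple.\<close>
  have d: "d (A \<union> B) ^ t = card {xs\<in>?X. ?R (A, B) xs}" for A B
  proof -
    have "{xs\<in>?X. ?R (A, B) xs} = {xs. set xs \<subseteq> {C \<in> G. (A \<union> B) \<inter> C = {}} \<and> length xs = t}"
      by auto
    then show ?thesis using fG by (simp add: card_lists_length_eq d_def)
  qed
  have "(\<Sum>(A, B)\<in>?E. d (A \<union> B) ^ t) = (\<Sum>p\<in>?E. card {xs\<in>?X. ?R p xs})"
    by (rule sum.cong) (auto simp: d split: prod.splits)
  also have "\<dots> = (\<Sum>xs\<in>?X. card {p\<in>?E. ?R p xs})"
    by (rule sum_multicount_gen[OF fE fX]) auto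
  also have "\<dots> = (\<Sum>xs\<in>?S. card {p\<in>?E. ?R p xs}) + (\<Sum>xs\<in>?X - ?S. card {p\<in>?E. ?R p xs})"
    using fX by (subst sum.subset_diff[of ?S ?X]) auto
  \<comment> \<open>Tuples with small union get the trivial bound on pairs. For the others the pair
    lives on at most \<open>card V - u\<close> points.\<close>
  also have "\<dots> \<le> (\<Sum>xs\<in>?S. card G ^ 2) + (\<Sum>xs\<in>?X - ?S. 3 ^ (card V - u))"
  proof (intro add_mono sum_mono)
    fix xs
    have "card {p\<in>?E. ?R p xs} \<le> card (G \<times> G)" using fG by (intro card_mono) auto
    then show "card {p\<in>?E. ?R p xs} \<le> card G ^ 2"
      by (simp add: card_cartesian_product power2_eq_square)
  next
    fix xs assume xs: "xs \<in> ?X - ?S"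
    let ?U = "\<Union>(set xs)"
    have U: "?U \<subseteq> V" "u < card ?U" using xs G by auto
    have "{p\<in>?E. ?R p xs} \<subseteq> {(A, B). A \<subseteq> V - ?U \<and> B \<subseteq> V - ?U \<and> A \<inter> B = {}}"
    proof clarify
      fix A B assume "A \<in> G" "B \<in> G" "A \<inter> B = {}" "?R (A, B) xs"
      then show "A \<subseteq> V - ?U \<and> B \<subseteq> V - ?U \<and> A \<inter> B = {}" using G by auto
    qed
    moreover have "finite {(A, B). A \<subseteq> V - ?U \<and> B \<subseteq> V - ?U \<and> A \<inter> B = {}}"
      by (rule finite_subset[of _ "Pow V \<times> Pow V"]) (use fin in auto)
    ultimately have "card {p\<in>?E. ?R p xs}
        \<le> card {(A, B). A \<subseteq> V - ?U \<and> B \<subseteq> V - ?U \<and> A \<inter> B = {}}"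
      by (rule card_mono[rotated])
    also have "\<dots> \<le> 3 ^ card (V - ?U)" using fin by (intro card_disjoint_pairs_le) simp
    also have "\<dots> \<le> 3 ^ (card V - u)"
      using U fin by (intro power_increasing) (auto simp: card_Diff_subset finite_subset)
    finally show "card {p\<in>?E. ?R p xs} \<le> 3 ^ (card V - u)" .
  qed
  also have "\<dots> = card ?S * card G ^ 2 + card (?X - ?S) * 3 ^ (card V - u)" by simp
  also have "\<dots> \<le> 2 ^ (card V + u * t) * card G ^ 2 + card G ^ t * 3 ^ (card V - u)"
  proof (intro add_mono mult_right_mono)
    show "card ?S \<le> 2 ^ (card V + u * t)" by (rule card_tuples_small_union_le[OF fin G])
    have "card (?X - ?S) \<le> card ?X" using fX by (intro card_mono) auto
    then show "card (?X - ?S) \<le> card G ^ t" using fG by (simp add: card_lists_length_eq)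
  qed auto
  finally show ?thesis .
qed

text \<open>Turns the bound on high moments of the codegree into one on the first moment, which
  counts ordered disjoint triples. A codegree \<open>x\<close> is either at most
  \<open>\<epsilon> * m\<close>, where \<open>m\<close> is the size of \<open>G\<close>, or at most
  \<open>x ^ Suc t / (\<epsilon> * m) ^ t\<close>.\<close>

lemma sum_codegree_le:
  fixes G :: "'a set set" and \<epsilon> :: real
  assumes fin: "finite V" and G: "G \<subseteq> Pow V" and "G \<noteq> {}" and "\<epsilon> > 0"
  defines "d \<equiv> \<lambda>C. card {B \<in> G. C \<inter> B = {}}"
  shows "(\<Sum>(A, B)\<in>{(A, B). A \<in> G \<and> B \<in> G \<and> A \<inter> B = {}}. real (d (A \<union> B)))
    \<le> \<epsilon> * real (card G) ^ 3 +
      (2 ^ (card V + u * Suc t) * real (card G) ^ 2 + real (card G) ^ Suc t * 3 ^ (card V - u))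
        / (\<epsilon> * real (card G)) ^ t"
proof -
  let ?E = "{(A, B). A \<in> G \<and> B \<in> G \<and> A \<inter> B = {}}"
  let ?m = "real (card G)"
  have fG: "finite G" using fin G finite_subset by blast
  have m: "?m > 0" using fG \<open>G \<noteq> {}\<close> by (simp add: card_gt_0_iff)
  have pt: "x \<le> \<epsilon> * ?m + x ^ Suc t / (\<epsilon> * ?m) ^ t" if "x \<ge> 0" for x :: real
  proof (cases "x \<le> \<epsilon> * ?m")
    case True
    have "0 \<le> x ^ Suc t / (\<epsilon> * ?m) ^ t" using that m \<open>\<epsilon> > 0\<close> by (intro divide_nonneg_pos) auto
    then show ?thesis using True by linarith
  next
    case False
    have "x * (\<epsilon> * ?m) ^ t \<le> x * x ^ t"
      using that m \<open>\<epsilon> > 0\<close> False by (intro mult_left_mono power_mono) auto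
    then have "x \<le> x ^ Suc t / (\<epsilon> * ?m) ^ t"
      using m \<open>\<epsilon> > 0\<close> by (simp add: pos_le_divide_eq)
    moreover have "0 \<le> \<epsilon> * ?m" using m \<open>\<epsilon> > 0\<close> by simp
    ultimately show ?thesis by linarith
  qed
  have cE: "card ?E \<le> card (G \<times> G)" using fG by (intro card_mono) auto
  have "(\<Sum>(A, B)\<in>?E. real (d (A \<union> B)))
      \<le> (\<Sum>(A, B)\<in>?E. \<epsilon> * ?m + real (d (A \<union> B)) ^ Suc t / (\<epsilon> * ?m) ^ t)"
    by (rule sum_mono) (use pt in \<open>auto simp del: power_Suc\<close>)
  also have "\<dots> = real (card ?E) * (\<epsilon> * ?m)
      + real (\<Sum>(A, B)\<in>?E. d (A \<union> B) ^ Suc t) / (\<epsilon> * ?m) ^ t"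
    by (simp add: case_prod_unfold sum.distrib sum_divide_distrib del: power_Suc)
  also have "\<dots> \<le> (?m * ?m) * (\<epsilon> * ?m)
      + real (2 ^ (card V + u * Suc t) * card G ^ 2 + card G ^ Suc t * 3 ^ (card V - u)) / (\<epsilon> * ?m) ^ t"
  proof -
    have "real (card ?E) \<le> real (card G * card G)"
      using cE by (simp only: card_cartesian_product of_nat_le_iff)
    then have "real (card ?E) * (\<epsilon> * ?m) \<le> (?m * ?m) * (\<epsilon> * ?m)"
      using m \<open>\<epsilon> > 0\<close> by (intro mult_right_mono) auto
    moreover have "real (\<Sum>(A, B)\<in>?E. d (A \<union> B) ^ Suc t)
        \<le> real (2 ^ (card V + u * Suc t) * card G ^ 2 + card G ^ Suc t * 3 ^ (card V - u))"
      using sum_codegree_power_le[OF fin G, of "Suc t" u] unfolding d_def by (rule of_nat_mono)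
    then have "real (\<Sum>(A, B)\<in>?E. d (A \<union> B) ^ Suc t) / (\<epsilon> * ?m) ^ t
        \<le> real (2 ^ (card V + u * Suc t) * card G ^ 2 + card G ^ Suc t * 3 ^ (card V - u)) / (\<epsilon> * ?m) ^ t"
      using m \<open>\<epsilon> > 0\<close> by (intro divide_right_mono zero_le_power) auto
    ultimately show ?thesis by (rule add_mono)
  qed
  also have "\<dots> = \<epsilon> * ?m ^ 3 +
      (2 ^ (card V + u * Suc t) * ?m ^ 2 + ?m ^ Suc t * 3 ^ (card V - u)) / (\<epsilon> * ?m) ^ t"
    by (simp add: power3_eq_cube algebra_simps)
  finally show ?thesis .
qed

section \<open>Stability for dense graphs with few triangles\<close>

text \<open>Mantel's theorem with stability, for graphs with few triangles. The bipartition is the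
  neighbourhood of a suitable vertex and its complement.\<close>

lemma few_triangles_stability:
  fixes G :: "'a set" and R :: "'a \<Rightarrow> 'a \<Rightarrow> bool" and \<sigma> :: real
  assumes fin: "finite G" and ne: "G \<noteq> {}" and sym: "\<And>A B. R A B \<Longrightarrow> R B A"
    and \<sigma>: "0 < \<sigma>" "\<sigma> \<le> 1"
  defines "N \<equiv> \<lambda>A. {B \<in> G. R A B}"
  defines "m \<equiv> real (card G)"
  defines "D \<equiv> \<Sum>A\<in>G. real (card (N A))"
  assumes D: "D \<ge> m\<^sup>2 / 2"
    and T: "(\<Sum>A\<in>G. \<Sum>B\<in>N A. real (card (N A \<inter> N B))) \<le> \<sigma>\<^sup>2 / 2 * m ^ 3"
  shows "D \<le> (1 + \<sigma>\<^sup>2) * m\<^sup>2 / 2"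
    and "\<exists>A\<in>G. \<bar>real (card (N A)) - m / 2\<bar> \<le> \<sigma> * m \<and>
      (\<Sum>B\<in>N A. real (card (G - N A - N B))) \<le> 3 * \<sigma> * m\<^sup>2"
proof -
  define d where "d A = real (card (N A))" for A
  define e where "e A = (\<Sum>B\<in>N A. real (card (N A \<inter> N B)))" for A
  have m: "m > 0" using fin ne by (simp add: m_def card_gt_0_iff)
  have fN: "finite (N A)" and NG: "N A \<subseteq> G" for A using fin by (auto simp: N_def)
  have e0: "e A \<ge> 0" for A by (simp add: e_def sum_nonneg)
  have D_d: "D = (\<Sum>A\<in>G. d A)" by (simp add: D_def d_def)
  have T_e: "(\<Sum>A\<in>G. e A) \<le> \<sigma>\<^sup>2 / 2 * m ^ 3" using T by (simp add: e_def)
  have "(\<Sum>A\<in>G. \<Sum>B\<in>N A. d B) = (\<Sum>B\<in>G. \<Sum>A\<in>{A \<in> G. R A B}. d B)"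
    unfolding N_def by (rule sum.swap_restrict[OF fin fin])
  also have "\<dots> = (\<Sum>B\<in>G. d B * d B)"
  proof (rule sum.cong[OF refl])
    fix B
    have "{A \<in> G. R A B} = N B" unfolding N_def using sym by blast
    then show "(\<Sum>A\<in>{A \<in> G. R A B}. d B) = d B * d B" by (simp add: d_def)
  qed
  finally have dB: "(\<Sum>A\<in>G. \<Sum>B\<in>N A. d B) = (\<Sum>B\<in>G. d B * d B)" .
  have dA: "(\<Sum>A\<in>G. \<Sum>B\<in>N A. d A) = (\<Sum>A\<in>G. d A * d A)" by (simp add: d_def)
  \<comment> \<open>Inclusion-exclusion for two neighbourhoods inside \<open>G\<close>. Summed over
    all edges, the left side becomes twice the sum of the squared degrees and the codegrees add up
    to the triangle count.\<close>
  have "d A + d B \<le> m + real (card (N A \<inter> N B))" for A B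
  proof -
    have "card (N A) + card (N B) = card (N A \<union> N B) + card (N A \<inter> N B)"
      by (rule card_Un_Int[OF fN fN])
    moreover have "card (N A \<union> N B) \<le> card G" using NG fin by (intro card_mono) auto
    ultimately show ?thesis unfolding d_def m_def by linarith
  qed
  then have "(\<Sum>A\<in>G. \<Sum>B\<in>N A. d A + d B) \<le> (\<Sum>A\<in>G. \<Sum>B\<in>N A. m + real (card (N A \<inter> N B)))"
    by (intro sum_mono)
  also have "\<dots> = D * m + (\<Sum>A\<in>G. e A)"
    by (simp add: sum.distrib e_def D_def sum_distrib_right)
  finally have sq: "2 * (\<Sum>A\<in>G. d A * d A) \<le> D * m + \<sigma>\<^sup>2 / 2 * m ^ 3"
    using dA dB T_e by (simp add: sum.distrib)
  have var_eq: "(\<Sum>A\<in>G. (d A - c)\<^sup>2) = (\<Sum>A\<in>G. d A * d A) - 2 * c * D + m * c\<^sup>2" for c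
  proof -
    have "(\<Sum>A\<in>G. (d A - c)\<^sup>2) = (\<Sum>A\<in>G. d A * d A - 2 * c * d A + c\<^sup>2)"
      by (intro sum.cong) (auto simp: power2_eq_square algebra_simps)
    then show ?thesis by (simp add: D_d m_def sum.distrib sum_subtractf sum_distrib_left)
  qed
  \<comment> \<open>Cauchy-Schwarz, obtained from the nonnegative variance about the mean degree
    \<open>D / m\<close>.\<close>
  have "(\<Sum>A\<in>G. (d A - D / m)\<^sup>2) = (\<Sum>A\<in>G. d A * d A) - 2 * (D / m) * D + m * (D / m)\<^sup>2"
    using var_eq[of "D / m"] by simp
  also have "\<dots> = (\<Sum>A\<in>G. d A * d A) - D * D / m"
    using m by (simp add: power2_eq_square field_simps)
  finally have CS: "D * D / m \<le> (\<Sum>A\<in>G. d A * d A)"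
    using sum_nonneg[of G "\<lambda>A. (d A - D / m)\<^sup>2"] by simp
  have "2 * (D * D / m) \<le> D * m + \<sigma>\<^sup>2 / 2 * m ^ 3" using CS sq by linarith
  then have "2 * (D * D / m) * m \<le> (D * m + \<sigma>\<^sup>2 / 2 * m ^ 3) * m"
    using m by (intro mult_right_mono) auto
  then have "2 * D * D \<le> D * m\<^sup>2 + \<sigma>\<^sup>2 * m\<^sup>2 * (m\<^sup>2 / 2)"
    using m by (simp add: power2_eq_square power3_eq_cube field_simps)
  \<comment> \<open>Replacing \<open>m^2 / 2\<close> by \<open>D\<close> makes \<open>D\<close> a
    common factor, which is then cancelled.\<close>
  also have "\<dots> \<le> D * m\<^sup>2 + \<sigma>\<^sup>2 * m\<^sup>2 * D" using D by (intro add_left_mono mult_left_mono) auto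
  finally have "D * (2 * D) \<le> D * (m\<^sup>2 + \<sigma>\<^sup>2 * m\<^sup>2)" by (simp add: algebra_simps)
  moreover have "D > 0" using D m by (smt (verit) half_gt_zero zero_less_power)
  ultimately have "2 * D \<le> m\<^sup>2 + \<sigma>\<^sup>2 * m\<^sup>2" by (simp only: mult_le_cancel_left_pos)
  then show "D \<le> (1 + \<sigma>\<^sup>2) * m\<^sup>2 / 2" by (simp add: algebra_simps)

  have "(\<Sum>A\<in>G. (d A - m / 2)\<^sup>2) = (\<Sum>A\<in>G. d A * d A) - m * D + m * (m / 2)\<^sup>2"
    using var_eq[of "m / 2"] by simp
  also have "\<dots> \<le> (D * m + \<sigma>\<^sup>2 / 2 * m ^ 3) / 2 - m * D + m * (m / 2)\<^sup>2"
    using sq by simp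
  also have "\<dots> = \<sigma>\<^sup>2 / 4 * m ^ 3 - (D - m\<^sup>2 / 2) * m / 2"
    by (simp add: power2_eq_square power3_eq_cube field_simps)
  also have "\<dots> \<le> \<sigma>\<^sup>2 / 4 * m ^ 3" using D m by simp
  finally have var: "(\<Sum>A\<in>G. (d A - m / 2)\<^sup>2) \<le> \<sigma>\<^sup>2 / 4 * m ^ 3" .

  have dev: "(\<Sum>A\<in>G. \<bar>d A - m / 2\<bar>) \<le> \<sigma> * m\<^sup>2"
  proof -
    \<comment> \<open>A form of the AM-GM inequality, which passes from the second moment of the
      deviations to the first.\<close>
    have "\<bar>x\<bar> \<le> x\<^sup>2 / (\<sigma> * m) + \<sigma> * m / 2" for x :: real
    proof -
      define s where "s = \<sigma> * m"
      have s: "s > 0" using \<sigma> m by (simp add: s_def)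
      have "0 \<le> (\<bar>x\<bar> - s / 2)\<^sup>2" by simp
      then have "\<bar>x\<bar> * s \<le> x\<^sup>2 + s\<^sup>2 / 4" by (simp add: power2_diff power_divide)
      also have "\<dots> \<le> (x\<^sup>2 / s + s / 2) * s" using s by (simp add: power2_eq_square algebra_simps)
      finally show ?thesis using s unfolding s_def[symmetric] by simp
    qed
    then have "(\<Sum>A\<in>G. \<bar>d A - m / 2\<bar>) \<le> (\<Sum>A\<in>G. (d A - m / 2)\<^sup>2 / (\<sigma> * m) + \<sigma> * m / 2)"
      by (intro sum_mono)
    also have "\<dots> = (\<Sum>A\<in>G. (d A - m / 2)\<^sup>2) / (\<sigma> * m) + m * (\<sigma> * m / 2)"
      by (simp add: sum.distrib sum_divide_distrib m_def)
    also have "\<dots> \<le> (\<sigma>\<^sup>2 / 4 * m ^ 3) / (\<sigma> * m) + m * (\<sigma> * m / 2)"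
      using var \<sigma> m by (intro add_right_mono divide_right_mono) auto
    also have "\<dots> = 3 / 4 * (\<sigma> * m\<^sup>2)"
      using \<sigma> m by (simp add: power2_eq_square power3_eq_cube field_simps)
    also have "\<dots> \<le> \<sigma> * m\<^sup>2" using \<sigma> by simp
    finally show ?thesis .
  qed
  \<comment> \<open>Averaging: the variance contributes 1/4 and the triangles 1/2, so the mean of
    this quantity is at most \<open>3/4 * \<sigma>^2 * m^2\<close>. One vertex thus has both nearly
    average degree and few triangles.\<close>
  have "\<exists>A\<in>G. (d A - m / 2)\<^sup>2 + e A \<le> \<sigma>\<^sup>2 * m\<^sup>2"
  proof (rule ccontr)
    assume "\<not> ?thesis"
    then have "(\<Sum>A\<in>G. \<sigma>\<^sup>2 * m\<^sup>2) \<le> (\<Sum>A\<in>G. (d A - m / 2)\<^sup>2 + e A)"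
      by (intro sum_mono) (simp add: not_le less_imp_le)
    also have "\<dots> \<le> 3 / 4 * (\<sigma>\<^sup>2 * m ^ 3)" using var T_e by (simp add: sum.distrib)
    finally have "\<sigma>\<^sup>2 * m ^ 3 \<le> 3 / 4 * (\<sigma>\<^sup>2 * m ^ 3)"
      by (simp add: m_def power2_eq_square power3_eq_cube algebra_simps)
    moreover have "\<sigma>\<^sup>2 * m ^ 3 > 0" using \<sigma> m by simp
    ultimately show False by linarith
  qed
  then obtain A where A: "A \<in> G" and A_le: "(d A - m / 2)\<^sup>2 + e A \<le> \<sigma>\<^sup>2 * m\<^sup>2" by blast
  have "(d A - m / 2)\<^sup>2 \<le> (\<sigma> * m)\<^sup>2" using A_le e0[of A] by (simp add: power_mult_distrib)
  then have dm: "\<bar>d A - m / 2\<bar> \<le> \<sigma> * m"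
    using \<sigma> m by (metis abs_le_square_iff abs_of_pos mult_pos_pos)
  have eA: "e A \<le> \<sigma>\<^sup>2 * m\<^sup>2" using A_le by (smt (verit) zero_le_power2)
  have ndeg: "real (card (G - N A - N B)) = m - d A - d B + real (card (N A \<inter> N B))" for B
  proof -
    have "G - N A - N B = G - (N A \<union> N B)" by blast
    then have "card (G - N A - N B) + card (N A \<union> N B) = card G"
      using NG fin by (metis Un_least card_Diff_subset card_mono finite_subset le_add_diff_inverse2)
    moreover have "card (N A) + card (N B) = card (N A \<union> N B) + card (N A \<inter> N B)"
      by (rule card_Un_Int[OF fN fN])
    ultimately show ?thesis unfolding d_def m_def by linarith
  qed
  have "(\<Sum>B\<in>N A. real (card (G - N A - N B))) = (\<Sum>B\<in>N A. (m / 2 - d A) - (d B - m / 2)) + e A"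
    by (simp add: ndeg e_def sum.distrib sum_subtractf algebra_simps)
  also have "\<dots> \<le> (\<Sum>B\<in>N A. \<sigma> * m + \<bar>d B - m / 2\<bar>) + e A"
    by (intro add_right_mono sum_mono) (use dm in linarith)
  also have "\<dots> = d A * (\<sigma> * m) + (\<Sum>B\<in>N A. \<bar>d B - m / 2\<bar>) + e A"
    by (simp add: sum.distrib d_def)
  also have "\<dots> \<le> m * (\<sigma> * m) + \<sigma> * m\<^sup>2 + \<sigma>\<^sup>2 * m\<^sup>2"
  proof (intro add_mono mult_right_mono eA)
    show "d A \<le> m" unfolding d_def m_def using NG fin by (simp add: card_mono)
    have "(\<Sum>B\<in>N A. \<bar>d B - m / 2\<bar>) \<le> (\<Sum>B\<in>G. \<bar>d B - m / 2\<bar>)"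
      using NG fin by (intro sum_mono2) auto
    then show "(\<Sum>B\<in>N A. \<bar>d B - m / 2\<bar>) \<le> \<sigma> * m\<^sup>2" using dev by linarith
  qed (use \<sigma> m in auto)
  also have "\<dots> \<le> 3 * \<sigma> * m\<^sup>2"
  proof -
    have "\<sigma>\<^sup>2 \<le> \<sigma>" using \<sigma> by (simp add: power2_eq_square mult_left_le)
    then have "\<sigma>\<^sup>2 * m\<^sup>2 \<le> \<sigma> * m\<^sup>2" by (intro mult_right_mono) auto
    then show ?thesis by (simp add: power2_eq_square algebra_simps)
  qed
  finally show "\<exists>A\<in>G. \<bar>real (card (N A)) - m / 2\<bar> \<le> \<sigma> * m \<and>
      (\<Sum>B\<in>N A. real (card (G - N A - N B))) \<le> 3 * \<sigma> * m\<^sup>2"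
    using A dm by (auto simp: d_def)
qed

section \<open>Disjoint triples in large families on \<open>2 * k\<close> points\<close>

text \<open>Takes 18th powers of codegrees and the cutoff \<open>k - j\<close> for the union, with
  \<open>j\<close> about \<open>k / 8\<close>. The cutoff is low enough that tuples with small union
  are rare, and high enough that at most \<open>k + j\<close> points remain for a disjoint pair.
  Each of the two contributions is at most \<open>M ^ 20 / 2 ^ j\<close>.\<close>

lemma few_disjoint_triples:
  fixes G :: "'a set set" and \<tau> :: real
  assumes fin: "finite V" and V: "card V = 2 * k" and G: "G \<subseteq> Pow V" and m: "2 ^ k \<le> card G"
    and "\<tau> > 0" and k: "8 * j \<le> k" "k \<le> 8 * j + 8" "16 \<le> j" and \<tau>: "2 * (2 / \<tau>) ^ 18 \<le> 2 ^ j"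
  defines "N \<equiv> \<lambda>A. {B \<in> G. A \<inter> B = {}}"
  shows "(\<Sum>A\<in>G. \<Sum>B\<in>N A. real (card (N A \<inter> N B))) \<le> \<tau> * real (card G) ^ 3"
proof -
  define M where "M = real (card G)"
  define \<epsilon> where "\<epsilon> = \<tau> / 2"
  have \<epsilon>: "\<epsilon> > 0" using \<open>\<tau> > 0\<close> by (simp add: \<epsilon>_def)
  have "real (2 ^ k) \<le> M" unfolding M_def using m by (rule of_nat_mono)
  then have M: "2 ^ k \<le> M" by simp
  have M0: "M > 0" using M by (smt (verit) zero_less_power)
  have fG: "finite G" using fin G finite_subset by blast
  have ne: "G \<noteq> {}" using m by auto
  have NN: "N A \<inter> N B = {C \<in> G. (A \<union> B) \<inter> C = {}}" for A B by (auto simp: N_def)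
  have SE: "Sigma G N = {(A, B). A \<in> G \<and> B \<in> G \<and> A \<inter> B = {}}" by (auto simp: N_def)
  have "(\<Sum>A\<in>G. \<Sum>B\<in>N A. real (card (N A \<inter> N B)))
      = (\<Sum>(A, B)\<in>Sigma G N. real (card (N A \<inter> N B)))"
    using fG by (intro sum.Sigma) (auto simp: N_def)
  also have "\<dots> \<le> \<epsilon> * M ^ 3 +
      (2 ^ (card V + (k - j) * Suc 17) * M ^ 2 + M ^ Suc 17 * 3 ^ (card V - (k - j))) / (\<epsilon> * M) ^ 17"
    using sum_codegree_le[OF fin G ne \<epsilon>, of "k - j" 17] unfolding NN SE M_def .
  also have "\<dots> \<le> \<epsilon> * M ^ 3 + (2 * M ^ 20 / 2 ^ j) / (\<epsilon> * M) ^ 17"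
  proof (intro add_left_mono divide_right_mono)
    \<comment> \<open>This amounts to \<open>2 * k <= 17 * j\<close>, which follows from
      \<open>k <= 8 * j + 8\<close> and \<open>16 <= j\<close>.\<close>
    have "2 * k + (k - j) * 18 + j \<le> k * 18" using k by (simp add: diff_mult_distrib)
    then have "(2::real) ^ (2 * k + (k - j) * 18 + j) \<le> 2 ^ (k * 18)" by (intro power_increasing) auto
    also have "\<dots> \<le> M ^ 18" unfolding power_mult using M by (intro power_mono) auto
    finally have "2 ^ (2 * k + (k - j) * 18) \<le> M ^ 18 / 2 ^ j"
      by (simp add: power_add pos_le_divide_eq)
    then have 1: "2 ^ (2 * k + (k - j) * 18) * M ^ 2 \<le> M ^ 18 / 2 ^ j * M ^ 2"
      by (intro mult_right_mono) auto
    obtain r where r: "k = 8 * j + r" using k(1) le_Suc_ex by blast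
    \<comment> \<open>Since \<open>k + j = 9 * j + r\<close>, everything reduces to the numerical
      fact \<open>3 ^ 9 * 2 <= 4 ^ 8\<close>; this is why \<open>j\<close> is about an eighth of
      \<open>k\<close>.\<close>
    have "(3::real) ^ (k + j) * 2 ^ j = (3 ^ 9 * 2) ^ j * 3 ^ r"
    proof -
      have "(3::real) ^ (k + j) * 2 ^ j = 3 ^ (9 * j) * 2 ^ j * 3 ^ r" by (simp add: r power_add[symmetric])
      also have "\<dots> = (3 ^ 9 * 2) ^ j * 3 ^ r" by (simp only: power_mult power_mult_distrib)
      finally show ?thesis .
    qed
    also have "\<dots> \<le> (4 ^ 8) ^ j * 4 ^ r" by (intro mult_mono power_mono) auto
    also have "\<dots> = (2 ^ k) ^ 2"
    proof -
      have "((4::real) ^ 8) ^ j * 4 ^ r = 4 ^ k" by (simp only: r power_add power_mult)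
      also have "\<dots> = (2 ^ k) ^ 2" by (simp flip: power_mult add: mult.commute[of k]) (simp add: power_mult)
      finally show ?thesis .
    qed
    also have "\<dots> \<le> M ^ 2" using M by (intro power_mono) auto
    finally have "3 ^ (k + j) \<le> M ^ 2 / 2 ^ j" by (simp add: pos_le_divide_eq)
    then have 2: "M ^ 18 * 3 ^ (k + j) \<le> M ^ 18 * (M ^ 2 / 2 ^ j)"
      using M0 by (intro mult_left_mono) auto
    have kj: "card V - (k - j) = k + j" using V k by simp
    have "M ^ 18 / 2 ^ j * M ^ 2 + M ^ 18 * (M ^ 2 / 2 ^ j) = 2 * M ^ 20 / 2 ^ j"
      by (simp add: power_add[symmetric])
    then show "2 ^ (card V + (k - j) * Suc 17) * M ^ 2 + M ^ Suc 17 * 3 ^ (card V - (k - j))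
        \<le> 2 * M ^ 20 / 2 ^ j"
      using 1 2 unfolding kj unfolding V by simp
  qed (use \<epsilon> M0 in auto)
  also have "\<dots> \<le> \<epsilon> * M ^ 3 + \<epsilon> * M ^ 3"
  proof -
    have "2 * (1 / \<epsilon>) ^ 18 \<le> 2 ^ j" using \<tau> by (simp add: \<epsilon>_def)
    then have "2 \<le> 2 ^ j * \<epsilon> ^ 18" using \<epsilon> by (simp add: power_divide pos_divide_le_eq)
    then have "2 * M ^ 20 \<le> (2 ^ j * \<epsilon> ^ 18) * M ^ 20" using M0 by (intro mult_right_mono) auto
    also have "\<dots> = (\<epsilon> * M ^ 3 * (\<epsilon> * M) ^ 17) * 2 ^ j"
      by (simp add: power_mult_distrib power_add[symmetric] mult_ac) (simp add: eval_nat_numeral)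
    finally have "2 * M ^ 20 / 2 ^ j \<le> \<epsilon> * M ^ 3 * (\<epsilon> * M) ^ 17" by (simp add: pos_divide_le_eq)
    then have "2 * M ^ 20 / 2 ^ j / (\<epsilon> * M) ^ 17 \<le> \<epsilon> * M ^ 3"
      using \<epsilon> M0 by (subst pos_divide_le_eq) auto
    then show ?thesis by linarith
  qed
  also have "\<dots> = \<tau> * M ^ 3" by (simp add: \<epsilon>_def)
  finally show ?thesis unfolding M_def .
qed

section \<open>Downsets of complements and their disjoint pairs\<close>

text \<open>The fibres of the union map are disjoint, and each fibre over \<open>U\<close> contains
  a pair in both orders. The resulting factor 2 is what brings the density of disjoint pairs up to
  one half.\<close>

lemma card_unions_le_card_pairs:
  assumes fin: "finite E"
    and ex: "\<And>X. X \<in> U \<Longrightarrow> \<exists>A B. (A, B) \<in> E \<and> (B, A) \<in> E \<and> A \<noteq> B \<and> A \<union> B = X"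
  shows "2 * card U \<le> card E"
proof -
  let ?F = "\<lambda>X. {p \<in> E. fst p \<union> snd p = X}"
  have "U \<subseteq> (\<lambda>p. fst p \<union> snd p) ` E" using ex by force
  then have fU: "finite U" using fin finite_surj by blast
  have ge: "2 \<le> card (?F X)" if X: "X \<in> U" for X
  proof -
    obtain A B where AB: "(A, B) \<in> E" "(B, A) \<in> E" "A \<noteq> B" "A \<union> B = X" using ex[OF X] by blast
    then have "card {(A, B), (B, A)} \<le> card (?F X)" using fin by (intro card_mono) auto
    then show ?thesis using AB(3) by simp
  qed
  have "2 * card U = (\<Sum>X\<in>U. 2)" by simp
  also have "\<dots> \<le> (\<Sum>X\<in>U. card (?F X))" by (intro sum_mono ge)
  also have "\<dots> = card (\<Union>X\<in>U. ?F X)"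
    using fU fin by (subst card_UN_disjoint) auto
  also have "\<dots> \<le> card E" using fin by (intro card_mono) auto
  finally show ?thesis .
qed

text \<open>Axioms for the complements of a maximal 3-wise intersecting family. From left to right,
  \<open>gen\<close> says that no three members cover \<open>V\<close>; from right to left it
  encodes maximality.\<close>

locale generating_downset =
  fixes V :: "'a set" and G :: "'a set set" and k :: nat
  assumes finV: "finite V" and cardV: "card V = 2 * k" and GV: "G \<subseteq> Pow V"
    and down: "A \<in> G \<Longrightarrow> B \<subseteq> A \<Longrightarrow> B \<in> G" and empty: "{} \<in> G"
    and gen: "X \<subseteq> V \<Longrightarrow> V - X \<in> G \<longleftrightarrow> (\<forall>A\<in>G. \<forall>B\<in>G. A \<union> B \<noteq> X)"
    and small: "card G + 3 \<le> 2 * 2 ^ k"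
begin

lemma finG: "finite G"
  using finV GV finite_subset by blast

text \<open>A set whose complement is not in \<open>G\<close> is a union \<open>A \<union> B\<close>
  of members, and replacing \<open>B\<close> by \<open>B - A\<close> makes the pair disjoint. The
  empty set is excluded because its only pair is \<open>({}, {})\<close>, which does not give two
  orders.\<close>

lemma card_disjoint_pairs_ge:
  "2 * 4 ^ k \<le> (\<Sum>A\<in>G. card {B \<in> G. A \<inter> B = {}}) + 2 * card G + 2"
proof -
  let ?E = "Sigma G (\<lambda>A. {B \<in> G. A \<inter> B = {}})"
  let ?U = "Pow V - insert {} ((\<lambda>X. V - X) ` G)"
  have fE: "finite ?E" using finG by auto
  have "2 * card ?U \<le> card ?E"
  proof (rule card_unions_le_card_pairs[OF fE])
    fix X assume X: "X \<in> ?U"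
    have "V - X \<notin> G"
    proof
      assume "V - X \<in> G"
      then have "V - (V - X) \<in> (\<lambda>X. V - X) ` G" by blast
      moreover have "V - (V - X) = X" using X by blast
      ultimately show False using X by simp
    qed
    then obtain A B where AB: "A \<in> G" "B \<in> G" "A \<union> B = X" using gen[of X] X by auto
    moreover from this have "B - A \<in> G" using down by blast
    moreover have "A \<noteq> B - A" using AB X by blast
    ultimately have "(A, B - A) \<in> ?E \<and> (B - A, A) \<in> ?E \<and> A \<noteq> B - A \<and> A \<union> (B - A) = X"
      by auto
    then show "\<exists>A B. (A, B) \<in> ?E \<and> (B, A) \<in> ?E \<and> A \<noteq> B \<and> A \<union> B = X" by blast
  qed
  moreover have "card (Pow V) \<le> card ?U + card (insert {} ((\<lambda>X. V - X) ` G))"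
    using finG diff_card_le_card_Diff[of "insert {} ((\<lambda>X. V - X) ` G)" "Pow V"] by simp
  moreover have "card (insert {} ((\<lambda>X. V - X) ` G)) \<le> Suc (card G)"
    using card_image_le[OF finG, of "\<lambda>X. V - X"] finG by (simp add: card_insert_if)
  moreover have "card (Pow V) = 4 ^ k" using finV by (simp add: card_Pow cardV power_mult)
  moreover have "card ?E = (\<Sum>A\<in>G. card {B \<in> G. A \<inter> B = {}})"
    using finG by (intro card_SigmaI) auto
  ultimately show ?thesis by linarith
qed

end

section \<open>From almost full cubes to the exact structure\<close>

context generating_downset
begin

text \<open>Let \<open>x\<close> and \<open>y\<close> be the numbers of missing subsets of \<open>S\<close> and of \<open>V - S\<close>, and \<open>z\<close> the number of
  members of \<open>G\<close> meeting both. Each of the roughly \<open>(x + y) 2 ^ k\<close> sets with a missing trace is the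
  complement of a member or uses one of the \<open>z\<close> mixed sets in its generation; the latter
  accounts for only \<open>z (x + y + z)\<close> of them, so \<open>x + y \<le> 2\<close>, and the size bound forces \<open>z = 0\<close>.\<close>

lemma eq_of_almost_cubes:
  assumes S: "S \<subseteq> V" "card S = k" and k: "6 \<le> k"
    and X: "20 * card (Pow S - G) \<le> 2 ^ k" and Y: "20 * card (Pow (V - S) - G) \<le> 2 ^ k"
  shows "G = {A. A \<subset> S} \<union> {B. B \<subset> V - S}"
proof -
  define W where "W = V - S"
  define MX where "MX = Pow S - G"
  define MY where "MY = Pow W - G"
  define Z where "Z = {M \<in> G. \<not> M \<subseteq> S \<and> \<not> M \<subseteq> W}"
  define N where "N = (2::nat) ^ k"
  let ?x = "card MX" and ?y = "card MY" and ?z = "card Z"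
  have fS: "finite S" and fW: "finite W" using finV S finite_subset by (auto simp: W_def)
  have SW: "S \<inter> W = {}" "S \<union> W = V" using S by (auto simp: W_def)
  have cW: "card W = k" using S finV fS by (simp add: W_def card_Diff_subset cardV)
  have PS: "card (Pow S) = N" and PW: "card (Pow W) = N"
    using fS fW S cW by (auto simp: card_Pow N_def)
  have fX: "finite MX" "finite MY" "finite Z"
    using fS fW finG by (auto simp: MX_def MY_def Z_def)
  have "(2::nat) ^ 6 \<le> 2 ^ k" using k by (intro power_increasing) auto
  then have N: "64 \<le> N" by (simp add: N_def)
  have xN: "20 * ?x \<le> N" "20 * ?y \<le> N" using X Y by (auto simp: MX_def MY_def W_def N_def)

  have cS: "card (G \<inter> Pow S) + ?x = N"
    using PS card_Int_Diff[of "Pow S" G] fS by (simp add: MX_def Int_commute)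
  have cWG: "card (G \<inter> Pow W) + ?y = N"
    using PW card_Int_Diff[of "Pow W" G] fW by (simp add: MY_def Int_commute)
  have "(G \<inter> Pow S) \<inter> (G \<inter> Pow W) = {{}}" using SW empty by auto
  then have "card (G \<inter> Pow S) + card (G \<inter> Pow W) = card ((G \<inter> Pow S) \<union> (G \<inter> Pow W)) + 1"
    using card_Un_Int[of "G \<inter> Pow S" "G \<inter> Pow W"] finG by simp
  moreover have "card G = card ((G \<inter> Pow S) \<union> (G \<inter> Pow W)) + ?z"
  proof -
    have "G = ((G \<inter> Pow S) \<union> (G \<inter> Pow W)) \<union> Z" by (auto simp: Z_def)
    moreover have "((G \<inter> Pow S) \<union> (G \<inter> Pow W)) \<inter> Z = {}" by (auto simp: Z_def)
    ultimately show ?thesis using card_Un_disjoint finG fX(3) by (metis finite_Int finite_Un)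
  qed
  \<comment> \<open>The empty set lies in both cubes, so \<open>G\<close> has
    \<open>2 * N - x - y - 1 + z\<close> members; this is compared with
    \<open>small\<close>.\<close>
  ultimately have zxy: "?z + 2 \<le> ?x + ?y"
    using small cS cWG unfolding N_def by linarith

  \<comment> \<open>\<open>?P\<close> holds the pairs of traces with at least one trace missing from
    \<open>G\<close>. If the complement of the union is in \<open>G\<close>, it is mixed
    (\<open>?Q1\<close>), inside \<open>W\<close> (\<open>?Q2\<close>) or inside \<open>S\<close>
    (\<open>?Q3\<close>). Otherwise the set is a union of two members: at least one mixed
    (\<open>?Q4\<close> to \<open>?Q6\<close>), or both on the same side (\<open>?Q7\<close>,
    \<open>?Q8\<close>).\<close>
  let ?P = "MX \<times> Pow W \<union> Pow S \<times> MY"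
  let ?Q1 = "(\<lambda>M. (S - M, W - M)) ` Z"
  let ?Q2 = "{S} \<times> Pow W" and ?Q3 = "Pow S \<times> {W}"
  let ?Q4 = "(\<lambda>(M, C). ((M \<union> C) \<inter> S, (M \<union> C) \<inter> W)) ` (Z \<times> Z)"
  let ?Q5 = "(\<lambda>(M, A). (A, M \<inter> W)) ` (Z \<times> MX)"
  let ?Q6 = "(\<lambda>(M, B). (M \<inter> S, B)) ` (Z \<times> MY)"
  let ?Q7 = "MX \<times> {{} :: 'a set}" and ?Q8 = "{{} :: 'a set} \<times> MY"
  \<comment> \<open>If \<open>C\<close> lies on one side, the trace on the other side comes from
    \<open>M\<close> alone and belongs to \<open>G\<close>, so the missing trace is the one on the
    side of \<open>C\<close>.\<close>
  have mixed: "(A, B) \<in> ?Q4 \<union> ?Q5 \<union> ?Q6"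
    if AB: "A \<subseteq> S" "B \<subseteq> W" "A \<notin> G \<or> B \<notin> G" and M: "M \<in> Z" and C: "C \<in> G"
      and U: "A \<union> B = M \<union> C" for A B M C
  proof -
    have A: "A = (M \<union> C) \<inter> S" and B: "B = (M \<union> C) \<inter> W"
      unfolding U[symmetric] using AB SW by blast+
    have MG: "M \<inter> S \<in> G" "M \<inter> W \<in> G" using M down by (auto simp: Z_def)
    consider "C \<in> Z" | "C \<subseteq> S" | "C \<subseteq> W" using C by (auto simp: Z_def)
    then show ?thesis
    proof cases
      case 1
      then have "(A, B) = (\<lambda>(M, C). ((M \<union> C) \<inter> S, (M \<union> C) \<inter> W)) (M, C)" "(M, C) \<in> Z \<times> Z"
        using A B M by auto
      then show ?thesis by blast
    next
      case 2
      then have BM: "B = M \<inter> W" using B SW by blast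
      then have "A \<in> MX" using AB MG by (auto simp: MX_def)
      then have "(A, B) = (\<lambda>(M, A). (A, M \<inter> W)) (M, A)" "(M, A) \<in> Z \<times> MX"
        using BM M by auto
      then show ?thesis by blast
    next
      case 3
      then have AM: "A = M \<inter> S" using A SW by blast
      then have "B \<in> MY" using AB MG by (auto simp: MY_def)
      then have "(A, B) = (\<lambda>(M, B). (M \<inter> S, B)) (M, B)" "(M, B) \<in> Z \<times> MY"
        using AM M by auto
      then show ?thesis by blast
    qed
  qed
  have sub: "?P \<subseteq> ?Q1 \<union> ?Q2 \<union> ?Q3 \<union> (?Q4 \<union> ?Q5 \<union> ?Q6) \<union> ?Q7 \<union> ?Q8"
  proof
    fix p assume "p \<in> ?P"
    then obtain A B where p: "p = (A, B)" and AB: "A \<subseteq> S" "B \<subseteq> W" "A \<notin> G \<or> B \<notin> G"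
      by (auto simp: MX_def MY_def)
    have XV: "A \<union> B \<subseteq> V" using AB SW by blast
    show "p \<in> ?Q1 \<union> ?Q2 \<union> ?Q3 \<union> (?Q4 \<union> ?Q5 \<union> ?Q6) \<union> ?Q7 \<union> ?Q8"
    proof (cases "V - (A \<union> B) \<in> G")
      case True
      have "S - (V - (A \<union> B)) = A" "W - (V - (A \<union> B)) = B" using AB SW by blast+
      then have Q1: "V - (A \<union> B) \<in> Z \<Longrightarrow> p \<in> ?Q1"
        unfolding p by (intro image_eqI[of _ _ "V - (A \<union> B)"]) auto
      have Q3: "V - (A \<union> B) \<subseteq> S \<Longrightarrow> p \<in> ?Q3" using AB SW p by auto
      have Q2: "V - (A \<union> B) \<subseteq> W \<Longrightarrow> p \<in> ?Q2" using AB SW p by auto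
      have "V - (A \<union> B) \<in> Z \<or> V - (A \<union> B) \<subseteq> S \<or> V - (A \<union> B) \<subseteq> W"
        using True unfolding Z_def mem_Collect_eq by satx
      then have "p \<in> ?Q1 \<or> p \<in> ?Q2 \<or> p \<in> ?Q3" using Q1 Q2 Q3 by satx
      then show ?thesis by (simp only: Un_iff) satx
    next
      case False
      then obtain C C' where C: "C \<in> G" "C' \<in> G" "C \<union> C' = A \<union> B" using gen[OF XV] by blast
      consider "C \<in> Z" | "C' \<in> Z" | "C \<subseteq> S" "C' \<subseteq> S" | "C \<subseteq> W" "C' \<subseteq> W"
        | "C \<subseteq> S" "C' \<subseteq> W" | "C \<subseteq> W" "C' \<subseteq> S"
        using C by (auto simp: Z_def)
      then show ?thesis
      proof cases
        case 1
        then have "(A, B) \<in> ?Q4 \<union> ?Q5 \<union> ?Q6" using C by (intro mixed[OF AB 1 C(2)]) simp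
        then show ?thesis unfolding p by (simp only: Un_iff simp_thms)
      next
        case 2
        then have "(A, B) \<in> ?Q4 \<union> ?Q5 \<union> ?Q6" using C by (intro mixed[OF AB 2 C(1)]) auto
        then show ?thesis unfolding p by (simp only: Un_iff simp_thms)
      next
        case 3
        then have "B = {}" using C AB SW by blast
        then have "p \<in> ?Q7" using p AB empty by (auto simp: MX_def)
        then show ?thesis by (simp only: Un_iff simp_thms)
      next
        case 4
        then have "A = {}" using C AB SW by blast
        then have "p \<in> ?Q8" using p AB empty by (auto simp: MY_def)
        then show ?thesis by (simp only: Un_iff simp_thms)
      next
        case 5
        then have "A = C" "B = C'" using C AB SW by blast+
        then show ?thesis using AB C by simp
      next
        case 6
        then have "A = C'" "B = C" using C AB SW by blast+
        then show ?thesis using AB C by simp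
      qed
    qed
  qed
  have "card ?P \<le> ?z + N + N + (?z * ?z + ?z * ?x + ?z * ?y) + ?x + ?y"
  proof -
    have "card ?P \<le> card (?Q1 \<union> ?Q2 \<union> ?Q3 \<union> (?Q4 \<union> ?Q5 \<union> ?Q6) \<union> ?Q7 \<union> ?Q8)"
      by (rule card_mono[OF _ sub]) (use fX fS fW in simp)
    also have "\<dots> \<le> card ?Q1 + card ?Q2 + card ?Q3 + (card ?Q4 + card ?Q5 + card ?Q6)
        + card ?Q7 + card ?Q8"
      by (intro order_trans[OF card_Un_le] add_mono order_refl)
    also have "\<dots> \<le> ?z + N + N + (?z * ?z + ?z * ?x + ?z * ?y) + ?x + ?y"
      using fX card_image_le[of "Z \<times> Z"] card_image_le[of "Z \<times> MX"] card_image_le[of "Z \<times> MY"]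
      by (intro add_mono) (auto simp: PS PW card_cartesian_product card_image_le)
    finally show ?thesis .
  qed
  moreover have "card ?P + ?x * ?y = ?x * N + N * ?y"
  proof -
    have "(MX \<times> Pow W) \<inter> (Pow S \<times> MY) = MX \<times> MY" by (auto simp: MX_def MY_def)
    then show ?thesis
      using card_Un_Int[of "MX \<times> Pow W" "Pow S \<times> MY"] fX fS fW
      by (simp add: card_cartesian_product PS PW)
  qed
  ultimately have main: "?x * N + N * ?y \<le> ?z + 2 * N + (?z * ?z + ?z * ?x + ?z * ?y) + ?x + ?y + ?x * ?y"
    by linarith
  \<comment> \<open>With \<open>s = x + y\<close> at least 3, the terms on the right of
    \<open>main\<close> are at most 2/3, 1/5, 1/20 and 1/32 of \<open>s * N\<close>, with sum below
    1. The factor 20 in the hypotheses leaves room for this.\<close>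
  have xy2: "?x + ?y \<le> 2"
  proof (rule ccontr)
    assume gt: "\<not> ?thesis"
    define s where "s = ?x + ?y"
    have s3: "3 \<le> s" and z: "?z \<le> s" and sN: "10 * s \<le> N" and xs: "?x \<le> s"
      using gt zxy xN by (auto simp: s_def)
    have 1: "?z * ?z \<le> s * ?z" using z by (rule mult_right_mono) simp
    have "s * (10 * ?z) \<le> s * N" using z sN by (intro mult_left_mono) auto
    then have 2: "10 * (s * ?z) \<le> s * N" by (simp add: mult_ac)
    have "?x * (20 * ?y) \<le> s * N" using xN xs by (intro mult_mono) auto
    then have 3: "20 * (?x * ?y) \<le> s * N" by (simp add: mult_ac)
    have 4: "s * N \<le> ?z + 2 * N + (?z * ?z + s * ?z) + s + ?x * ?y"
      using main by (simp add: s_def algebra_simps)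
    have 5: "3 * N \<le> s * N" using s3 by (rule mult_right_mono) simp
    have 6: "s * 64 \<le> s * N" using N by (rule mult_left_mono) simp
    show False using 1 2 3 4 5 6 z N s3 by linarith
  qed
  then have "?z = 0" and xy: "?x + ?y = 2" using zxy by simp_all
  then have Z0: "Z = {}" using fX by simp

  \<comment> \<open>If \<open>S\<close> were a member, the complement \<open>W - B\<close> of
    \<open>S \<union> B\<close> would be missing for every member \<open>B\<close> inside
    \<open>W\<close>, far more than the at most two missing sets. The same holds for
    \<open>W\<close>, so each side misses exactly its top set.\<close>
  have "S \<notin> G"
  proof
    assume SG: "S \<in> G"
    have "(\<lambda>B. W - B) ` (G \<inter> Pow W) \<subseteq> MY"
    proof clarify
      fix B assume B: "B \<in> G" "B \<subseteq> W"
      have "V - (S \<union> B) = W - B" using SW by blast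
      then show "W - B \<in> MY" using gen[of "S \<union> B"] SG B SW by (auto simp: MY_def)
    qed
    moreover have "inj_on (\<lambda>B. W - B) (G \<inter> Pow W)" by (rule inj_onI) blast
    ultimately have "card (G \<inter> Pow W) \<le> ?y" using fX by (metis card_inj_on_le)
    then show False using cWG xy N by linarith
  qed
  moreover have "W \<notin> G"
  proof
    assume WG: "W \<in> G"
    have "(\<lambda>B. S - B) ` (G \<inter> Pow S) \<subseteq> MX"
    proof clarify
      fix B assume B: "B \<in> G" "B \<subseteq> S"
      have "V - (W \<union> B) = S - B" using SW by blast
      then show "S - B \<in> MX" using gen[of "W \<union> B"] WG B SW by (auto simp: MX_def)
    qed
    moreover have "inj_on (\<lambda>B. S - B) (G \<inter> Pow S)" by (rule inj_onI) blast
    ultimately have "card (G \<inter> Pow S) \<le> ?x" using fX by (metis card_inj_on_le)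
    then show False using cS xy N by linarith
  qed
  ultimately have "S \<in> MX" "W \<in> MY" by (auto simp: MX_def MY_def)
  then have "?x \<noteq> 0" "?y \<noteq> 0" using fX by auto
  then have "?x = 1" "?y = 1" using xy by linarith+
  then have "MX = {S}" "MY = {W}" using \<open>S \<in> MX\<close> \<open>W \<in> MY\<close> by (auto simp: card_1_singleton_iff)
  moreover have "A \<in> G \<longleftrightarrow> (A \<subseteq> S \<and> A \<notin> MX) \<or> (A \<subseteq> W \<and> A \<notin> MY)" for A
    using Z0 by (auto simp: MX_def MY_def Z_def)
  ultimately show ?thesis unfolding W_def[symmetric] by blast
qed

section \<open>From graph stability to two almost full cubes\<close>

text \<open>Stability yields a member \<open>A\<close> whose neighbourhood is about half of
  \<open>G\<close> and nearly completely joined to the rest. Let \<open>S\<close> be the union of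
  the neighbours with few non-neighbours outside \<open>N A\<close>. Most of \<open>N A\<close> then
  lies inside \<open>S\<close>, and most of the rest avoids \<open>S\<close>. Each side carries more
  than half of \<open>2 ^ k\<close> sets, so neither has fewer than \<open>k\<close> points.\<close>

lemma almost_cubes:
  assumes k: "6 \<le> k" and j: "8 * j \<le> k" "k \<le> 8 * j + 8" "16 \<le> j"
    and large: "2 * (14400000000 * (real k)\<^sup>2) ^ 18 \<le> 2 ^ j"
  obtains S where "S \<subseteq> V" "card S = k" "20 * card (Pow S - G) \<le> 2 ^ k"
    "20 * card (Pow (V - S) - G) \<le> 2 ^ k"
proof -
  define N where "N A = {B \<in> G. A \<inter> B = {}}" for A
  define m where "m = real (card G)"
  define q where "q = (2::real) ^ k"
  define D where "D = (\<Sum>A\<in>G. real (card (N A)))"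
  \<comment> \<open>Chosen so that \<open>3 * \<sigma> * m^2\<close> is \<open>m / 100\<close> times
    the threshold \<open>m / (200 * real k)\<close> in \<open>good\<close>. The constant 14400000000
    in \<open>large\<close> is \<open>4 / \<sigma>^2\<close> without the factor
    \<open>k^2\<close>.\<close>
  define \<sigma> where "\<sigma> = 1 / (60000 * real k)"
  have k0: "real k \<ge> 6" using k by simp
  have \<sigma>: "0 < \<sigma>" "\<sigma> \<le> 1 / 1000" using k0 by (auto simp: \<sigma>_def field_simps)
  have "(2::real) ^ 6 \<le> 2 ^ k" using k by (intro power_increasing) auto
  then have q: "q \<ge> 64" by (simp add: q_def)
  have ne: "G \<noteq> {}" using empty by auto
  have m_le: "m \<le> 2 * q - 3"
  proof -
    have "real (card G + 3) \<le> real (2 * 2 ^ k)" using small by (rule of_nat_mono)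
    then show ?thesis by (simp add: m_def q_def)
  qed
  have m0: "m \<ge> 0" by (simp add: m_def)
  have D_ge: "2 * q\<^sup>2 \<le> D + 2 * m + 2"
  proof -
    have "real (2 * 4 ^ k) \<le> real ((\<Sum>A\<in>G. card (N A)) + 2 * card G + 2)"
      unfolding N_def by (rule of_nat_mono[OF card_disjoint_pairs_ge])
    moreover have "(4::real) ^ k = q\<^sup>2"
      by (simp add: q_def power2_eq_square flip: power_mult_distrib)
    ultimately show ?thesis by (simp add: D_def m_def)
  qed
  have D_le: "D \<le> m\<^sup>2"
  proof -
    have "D \<le> (\<Sum>A\<in>G. m)" unfolding D_def m_def using finG by (intro sum_mono) (auto simp: N_def intro: card_mono)
    then show ?thesis by (simp add: m_def power2_eq_square)
  qed
  have "m \<ge> q"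
  proof (rule ccontr)
    assume *: "\<not> ?thesis"
    then have "m\<^sup>2 \<le> q\<^sup>2" using m0 by (intro power_mono) auto
    then have "q * q \<le> 2 * q + 2" using D_le D_ge * by (simp add: power2_eq_square)
    moreover have "64 * q \<le> q * q" using q by (intro mult_right_mono) auto
    ultimately show False using q by linarith
  qed
  then have "real (2 ^ k) \<le> real (card G)" by (simp add: q_def m_def)
  then have m_ge: "2 ^ k \<le> card G" by (simp only: of_nat_le_iff)
  \<comment> \<open>Squaring \<open>2 * q - 3\<close> loses about \<open>12 * q\<close> from
    \<open>4 * q^2\<close>, which absorbs the linear loss \<open>2 * m + 2\<close> in
    \<open>D_ge\<close>.\<close>
  have D_half: "m\<^sup>2 / 2 \<le> D"
  proof -
    have "m\<^sup>2 \<le> (2 * q - 3)\<^sup>2" using m_le m0 by (intro power_mono)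
    also have "\<dots> = 4 * q\<^sup>2 - 12 * q + 9" by (simp add: power2_eq_square algebra_simps)
    finally show ?thesis using D_ge m_le q by linarith
  qed
  have T: "(\<Sum>A\<in>G. \<Sum>B\<in>N A. real (card (N A \<inter> N B))) \<le> \<sigma>\<^sup>2 / 2 * m ^ 3"
    unfolding N_def m_def
  proof (rule few_disjoint_triples[OF finV cardV GV m_ge _ j])
    have "2 / (\<sigma>\<^sup>2 / 2) = 14400000000 * (real k)\<^sup>2"
      by (simp add: \<sigma>_def power2_eq_square)
    then show "2 * (2 / (\<sigma>\<^sup>2 / 2)) ^ 18 \<le> 2 ^ j" using large by simp
  qed (use \<sigma> in auto)
  have sym: "A \<inter> B = {} \<Longrightarrow> B \<inter> A = {}" for A B :: "'a set" by blast
  have \<sigma>1: "\<sigma> \<le> 1" using \<sigma> by simp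
  note stab = few_triangles_stability[where R = "\<lambda>A B. A \<inter> B = {}", OF finG ne sym \<sigma>(1) \<sigma>1,
      folded N_def m_def, folded D_def, OF _ D_half T]
  have D_up: "D \<le> (1 + \<sigma>\<^sup>2) * m\<^sup>2 / 2" by (rule stab(1))
  \<comment> \<open>\<open>D\<close> is about \<open>2 * q^2\<close> or more, yet at most slightly
    above \<open>m^2 / 2\<close>, so \<open>m\<close> is close to \<open>2 * q\<close>. The value
    1.96 leaves 0.95 \<open>q\<close> on each side after losses of \<open>m / 1000\<close> and
    \<open>m / 100\<close>.\<close>
  have m_big: "196 / 100 * q \<le> m"
  proof (rule ccontr)
    assume *: "\<not> ?thesis"
    then have "m\<^sup>2 \<le> (196 / 100 * q)\<^sup>2" using m0 by (intro power_mono) auto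
    moreover have "\<sigma>\<^sup>2 \<le> (1 / 1000)\<^sup>2" using \<sigma> by (intro power_mono) auto
    ultimately have "(1 + \<sigma>\<^sup>2) * m\<^sup>2 \<le> (1 + (1 / 1000)\<^sup>2) * (196 / 100 * q)\<^sup>2"
      by (intro mult_mono) auto
    also have "\<dots> \<le> 385 / 100 * (q * q)" by (simp add: power2_eq_square)
    finally have "2 * (q * q) \<le> 385 / 200 * (q * q) + 2 * m + 2"
      using D_up D_ge by (simp add: power2_eq_square)
    moreover have "64 * q \<le> q * q" using q by (intro mult_right_mono) auto
    ultimately show False using * q by linarith
  qed
  have mp: "m > 0" using m_big q by linarith
  obtain A where A: "A \<in> G" "\<bar>real (card (N A)) - m / 2\<bar> \<le> \<sigma> * m"
    and nonedges: "(\<Sum>B\<in>N A. real (card (G - N A - N B))) \<le> 3 * \<sigma> * m\<^sup>2"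
    using stab(2) by blast
  have \<sigma>m: "\<sigma> * m \<le> m / 1000" using mult_right_mono[OF \<sigma>(2) m0] by simp
  define good where "good = {B \<in> N A. real (card (G - N A - N B)) \<le> m / (200 * real k)}"
  define S where "S = \<Union>good"
  have NG: "N B \<subseteq> G" for B by (auto simp: N_def)
  have fN: "finite (N B)" for B using NG finG finite_subset by blast
  have SV: "S \<subseteq> V" using NG GV by (auto simp: S_def good_def)
  have fS: "finite S" using SV finV finite_subset by blast
  have bad: "real (card (N A - good)) \<le> m / 100"
  proof -
    have "real (card (N A - good)) * (m / (200 * real k)) = (\<Sum>B\<in>N A - good. m / (200 * real k))"
      by simp
    also have "\<dots> \<le> (\<Sum>B\<in>N A - good. real (card (G - N A - N B)))"
      by (intro sum_mono) (auto simp: good_def)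
    also have "\<dots> \<le> (\<Sum>B\<in>N A. real (card (G - N A - N B)))"
      by (intro sum_mono2 fN) auto
    also have "\<dots> \<le> 3 * \<sigma> * m\<^sup>2" by (rule nonedges)
    also have "\<dots> = m / 100 * (m / (200 * real k))"
      using k0 by (simp add: \<sigma>_def power2_eq_square)
    finally show ?thesis by (rule mult_right_le_imp_le) (use mp k0 in simp)
  qed
  have "card (N A) \<le> card (G \<inter> Pow S) + card (N A - good)"
  proof -
    have "card (N A) \<le> card ((G \<inter> Pow S) \<union> (N A - good))"
      using NG finG fN by (intro card_mono) (auto simp: S_def good_def)
    then show ?thesis using card_Un_le le_trans by blast
  qed
  then have S_ge: "95 / 100 * q \<le> real (card (G \<inter> Pow S))"
    using A(2) bad \<sigma>m m_big by linarith
  have "card S \<le> 2 * k" using SV card_mono[OF finV] cardV by metis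
  \<comment> \<open>For each point \<open>i\<close> of \<open>S\<close> the choice operator fixes
    one good set containing \<open>i\<close>. A set outside \<open>N A\<close> that contains
    \<open>i\<close> is a non-neighbour of it, and a union bound over at most \<open>2 * k\<close>
    points costs \<open>m / 100\<close>.\<close>
  have "card (G - N A) \<le> card (G \<inter> Pow (V - S)) + card (\<Union>i\<in>S. G - N A - N (SOME B. B \<in> good \<and> i \<in> B))"
  proof -
    have "G - N A \<subseteq> (G \<inter> Pow (V - S)) \<union> (\<Union>i\<in>S. G - N A - N (SOME B. B \<in> good \<and> i \<in> B))"
    proof
      fix C assume C: "C \<in> G - N A"
      show "C \<in> (G \<inter> Pow (V - S)) \<union> (\<Union>i\<in>S. G - N A - N (SOME B. B \<in> good \<and> i \<in> B))"
      proof (cases "C \<inter> S = {}")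
        case True
        then show ?thesis using C GV by auto
      next
        case False
        then obtain i where i: "i \<in> C" "i \<in> S" by blast
        let ?B = "SOME B. B \<in> good \<and> i \<in> B"
        have "\<exists>B. B \<in> good \<and> i \<in> B" using i by (auto simp: S_def)
        then have "?B \<in> good \<and> i \<in> ?B" by (rule someI_ex)
        then have "C \<notin> N ?B" using i by (auto simp: N_def)
        then show ?thesis using C i by blast
      qed
    qed
    moreover have "finite ((G \<inter> Pow (V - S)) \<union> (\<Union>i\<in>S. G - N A - N (SOME B. B \<in> good \<and> i \<in> B)))"
      using finG fS by simp
    ultimately show ?thesis by (rule order_trans[OF card_mono card_Un_le, rotated])
  qed
  moreover have "real (card (\<Union>i\<in>S. G - N A - N (SOME B. B \<in> good \<and> i \<in> B))) \<le> m / 100"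
  proof -
    have "real (card (\<Union>i\<in>S. G - N A - N (SOME B. B \<in> good \<and> i \<in> B)))
        \<le> real (\<Sum>i\<in>S. card (G - N A - N (SOME B. B \<in> good \<and> i \<in> B)))"
      by (rule of_nat_mono[OF card_UN_le[OF fS]])
    also have "\<dots> = (\<Sum>i\<in>S. real (card (G - N A - N (SOME B. B \<in> good \<and> i \<in> B))))" by simp
    also have "\<dots> \<le> (\<Sum>i\<in>S. m / (200 * real k))"
    proof (rule sum_mono)
      fix i assume "i \<in> S"
      then have "\<exists>B. B \<in> good \<and> i \<in> B" by (auto simp: S_def)
      then have "(SOME B. B \<in> good \<and> i \<in> B) \<in> good" by (metis (mono_tags, lifting) someI_ex)
      then show "real (card (G - N A - N (SOME B. B \<in> good \<and> i \<in> B))) \<le> m / (200 * real k)"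
        by (simp add: good_def)
    qed
    also have "\<dots> = real (card S) * (m / (200 * real k))" by simp
    also have "\<dots> \<le> (2 * real k) * (m / (200 * real k))"
      using \<open>card S \<le> 2 * k\<close> m0 by (intro mult_right_mono) auto
    also have "\<dots> = m / 100" using k0 by simp
    finally show ?thesis .
  qed
  moreover have "real (card (G - N A)) = m - real (card (N A))"
    using NG fN finG by (simp add: card_Diff_subset m_def of_nat_diff card_mono)
  ultimately have W_ge: "95 / 100 * q \<le> real (card (G \<inter> Pow (V - S)))"
    using A(2) \<sigma>m m_big by linarith
  have card_ge: "k \<le> card Y" if "finite Y" "95 / 100 * q \<le> real (card (G \<inter> Pow Y))" for Y
  proof (rule ccontr)
    assume "\<not> k \<le> card Y"
    then have "card Y + 1 \<le> k" by simp
    then have "(2::real) ^ (card Y + 1) \<le> 2 ^ k" by (intro power_increasing) auto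
    then have "2 * 2 ^ card Y \<le> q" by (simp add: q_def)
    moreover have "card (G \<inter> Pow Y) \<le> card (Pow Y)" using that by (intro card_mono) auto
    then have "real (card (G \<inter> Pow Y)) \<le> 2 ^ card Y"
      using that of_nat_le_iff[where 'a = real, of _ "2 ^ card Y"] by (simp add: card_Pow)
    ultimately show False using that q by linarith
  qed
  have "card (V - S) = 2 * k - card S" using SV fS cardV by (simp add: card_Diff_subset)
  moreover have "k \<le> card S" by (rule card_ge[OF fS S_ge])
  moreover have "k \<le> card (V - S)" using card_ge[OF _ W_ge] finV by simp
  ultimately have cS: "card S = k" and cW: "card (V - S) = k"
    using \<open>card S \<le> 2 * k\<close> by linarith+
  have miss: "20 * card (Pow Y - G) \<le> 2 ^ k"
    if "finite Y" "card Y = k" "95 / 100 * q \<le> real (card (G \<inter> Pow Y))" for Y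
  proof -
    have "card (G \<inter> Pow Y) + card (Pow Y - G) = 2 ^ k"
      using card_Int_Diff[of "Pow Y" G] that by (simp add: Int_commute card_Pow)
    then have "real (card (G \<inter> Pow Y)) + real (card (Pow Y - G)) = q"
      unfolding q_def by (metis of_nat_add of_nat_numeral of_nat_power)
    then have "real (20 * card (Pow Y - G)) \<le> real (2 ^ k)" using that(3) by (simp add: q_def)
    then show ?thesis by (simp only: of_nat_le_iff)
  qed
  show ?thesis
    using that[OF SV cS miss[OF fS cS S_ge] miss[OF _ cW W_ge]] finV by simp
qed

end

section \<open>Threshold, passage to complements and conclusion\<close>

lemma exists_large_threshold:
  "\<exists>k0. \<forall>k\<ge>k0. 2 * (14400000000 * (real k)\<^sup>2) ^ 18 \<le> 2 ^ (k div 8)"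
proof -
  have "eventually (\<lambda>k::nat. 2 * (14400000000 * (real k)\<^sup>2) ^ 18 \<le> 2 powr (real k / 8 - 1)) sequentially"
    by real_asymp
  then obtain k0 where k0: "\<And>k. k \<ge> k0 \<Longrightarrow>
      2 * (14400000000 * (real k)\<^sup>2) ^ 18 \<le> 2 powr (real k / 8 - 1)"
    by (auto simp: eventually_sequentially)
  have "2 * (14400000000 * (real k)\<^sup>2) ^ 18 \<le> 2 ^ (k div 8)" if "k \<ge> k0" for k
  proof -
    have "real k / 8 - 1 \<le> real (k div 8)" by linarith
    then have "2 powr (real k / 8 - 1) \<le> 2 powr real (k div 8)" by (intro powr_mono) auto
    then show ?thesis using k0[OF that] by (simp add: powr_realpow)
  qed
  then show ?thesis by blast
qed

text \<open>A set outside \<open>F\<close> is blocked by at most two members of \<open>F\<close>;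
  repeating or adding a member makes them exactly two, \<open>B\<close> and \<open>C\<close>.
  Closure under supersets follows: a blocker of a superset also blocks the smaller set.\<close>

lemma generating_downset_complements:
  assumes F: "maximal_k_wise_intersecting (2 * k) 3 F" and card: "card F + 3 \<le> 2 * 2 ^ k" and "0 < k"
  shows "generating_downset (ground (2 * k)) ((\<lambda>X. ground (2 * k) - X) ` F) k"
proof -
  let ?V = "ground (2 * k)"
  let ?G = "(\<lambda>X. ?V - X) ` F"
  have FV: "F \<subseteq> Pow ?V" and inter: "k_wise_intersecting 3 F"
    and max: "\<And>A. A \<subseteq> ?V \<Longrightarrow> A \<notin> F \<Longrightarrow> \<not> k_wise_intersecting 3 (insert A F)"
    using F by (auto simp: maximal_k_wise_intersecting_def)
  have fV: "finite ?V" by (simp add: ground_def)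
  have fF: "finite F" using FV fV finite_subset by blast
  have int3: "A \<inter> B \<inter> C \<noteq> {}" if "A \<in> F" "B \<in> F" "C \<in> F" for A B C
  proof -
    have "card {A, B, C} \<le> 3" by (simp add: card_insert_if)
    then have "{A, B, C} \<subseteq> F \<and> {A, B, C} \<noteq> {} \<and> card {A, B, C} \<le> 3" using that by blast
    from inter[unfolded k_wise_intersecting_def, rule_format, OF this]
    have "\<Inter>{A, B, C} \<noteq> {}" .
    then show ?thesis by (simp add: Int_assoc)
  qed
  have witness: "\<exists>H. H \<subseteq> F \<and> card H \<le> 2 \<and> A \<inter> \<Inter>H = {}" if A: "A \<subseteq> ?V" "A \<notin> F" for A
  proof -
    obtain H where H: "H \<subseteq> insert A F" "H \<noteq> {}" "card H \<le> 3" "\<Inter>H = {}"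
      using max[OF A] unfolding k_wise_intersecting_def by blast
    have "A \<in> H"
    proof (rule ccontr)
      assume "A \<notin> H"
      then have "H \<subseteq> F" using H by blast
      then show False using inter H unfolding k_wise_intersecting_def by blast
    qed
    moreover have "finite H" using H fF finite_subset by blast
    ultimately have "card (H - {A}) \<le> 2" using H by simp
    moreover have "A \<inter> \<Inter>(H - {A}) = {}" using H \<open>A \<in> H\<close> by blast
    ultimately show ?thesis using H by blast
  qed
  \<comment> \<open>With \<open>F\<close> empty the only witness is \<open>{}\<close>, and
    \<open>\<Inter>{}\<close> is the whole type, so \<open>?V\<close> itself would be empty.\<close>
  have ne: "F \<noteq> {}"
  proof
    assume "F = {}"
    then have "?V = {}" using witness[of ?V] by auto
    then show False using \<open>0 < k\<close> by (simp add: ground_def)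
  qed
  have two: "\<exists>B\<in>F. \<exists>C\<in>F. A \<inter> B \<inter> C = {}" if A: "A \<subseteq> ?V" "A \<notin> F" for A
  proof -
    obtain H where H: "H \<subseteq> F" "card H \<le> 2" "A \<inter> \<Inter>H = {}" using witness[OF A] by blast
    have "\<exists>B\<in>F. \<exists>C\<in>F. H \<subseteq> {B, C}"
    proof (cases "card H = 0")
      case True
      then have "H = {}" using H fF finite_subset by fastforce
      then show ?thesis using ne by blast
    next
      case False
      then consider "card H = 1" | "card H = 2" using H by linarith
      then show ?thesis
      proof cases
        case 1
        then show ?thesis using H by (auto simp: card_1_singleton_iff)
      next
        case 2
        then show ?thesis using H by (auto simp: card_2_iff)
      qed
    qed
    then obtain B C where BC: "B \<in> F" "C \<in> F" "H \<subseteq> {B, C}" by blast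
    then have "B \<inter> C \<subseteq> \<Inter>H" by (intro Inter_greatest) auto
    then have "A \<inter> B \<inter> C = {}" using H(3) by auto
    then show ?thesis using BC by blast
  qed
  have up: "B \<in> F" if AB: "A \<in> F" "A \<subseteq> B" "B \<subseteq> ?V" for A B
  proof (rule ccontr)
    assume "B \<notin> F"
    then obtain C E where "C \<in> F" "E \<in> F" "B \<inter> C \<inter> E = {}" using two[OF AB(3)] by blast
    then show False using int3[of A C E] AB by blast
  qed
  have mem: "X \<in> ?G \<longleftrightarrow> ?V - X \<in> F" if "X \<subseteq> ?V" for X
  proof
    assume "?V - X \<in> F"
    then have "?V - (?V - X) \<in> ?G" by blast
    then show "X \<in> ?G" using that by (simp add: double_diff)
  qed (use FV in \<open>auto simp: double_diff\<close>)
  show ?thesis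
  proof
    show "card ?V = 2 * k" by (simp add: ground_def)
    show dn: "B \<in> ?G" if "A \<in> ?G" "B \<subseteq> A" for A B
    proof -
      have "A \<subseteq> ?V" using that by blast
      then have "?V - A \<in> F" using that mem by blast
      then have "?V - B \<in> F" using up that by blast
      then show ?thesis using mem that \<open>A \<subseteq> ?V\<close> by blast
    qed
    show "{} \<in> ?G" using dn ne by blast
    show "?V - X \<in> ?G \<longleftrightarrow> (\<forall>A\<in>?G. \<forall>B\<in>?G. A \<union> B \<noteq> X)" if X: "X \<subseteq> ?V" for X
    proof -
      have "?V - X \<in> ?G \<longleftrightarrow> X \<in> F" using mem[of "?V - X"] X by (simp add: double_diff)
      also have "\<dots> \<longleftrightarrow> (\<forall>A\<in>?G. \<forall>B\<in>?G. A \<union> B \<noteq> X)"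
      proof
        assume "X \<in> F"
        then have "X \<inter> A \<inter> B \<noteq> {}" if "A \<in> F" "B \<in> F" for A B using int3 that by blast
        then show "\<forall>A\<in>?G. \<forall>B\<in>?G. A \<union> B \<noteq> X" by blast
      next
        assume no: "\<forall>A\<in>?G. \<forall>B\<in>?G. A \<union> B \<noteq> X"
        show "X \<in> F"
        proof (rule ccontr)
          assume "X \<notin> F"
          then obtain B C where BC: "B \<in> F" "C \<in> F" "X \<inter> B \<inter> C = {}" using two[OF X] by blast
          \<comment> \<open>The complements of \<open>B\<close> and \<open>C\<close> only cover
            \<open>X\<close>; cutting them down to \<open>X\<close>, which the downset property
            allows, makes the union equal to \<open>X\<close>.\<close>
          have "(?V - B) \<inter> X \<in> ?G" "(?V - C) \<inter> X \<in> ?G"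
            by (rule dn[OF imageI[OF BC(1)] Int_lower1], rule dn[OF imageI[OF BC(2)] Int_lower1])
          moreover have "((?V - B) \<inter> X) \<union> ((?V - C) \<inter> X) = X" using BC X by blast
          ultimately show False using no by blast
        qed
      qed
      finally show ?thesis .
    qed
    have "card ?G \<le> card F" by (rule card_image_le[OF fF])
    then show "card ?G + 3 \<le> 2 * 2 ^ k" using card by linarith
  qed (use fV in auto)
qed

theorem theorem1p1:
  shows "\<exists>n0::nat. \<forall>n::nat. even n \<and> n \<ge> n0 \<longrightarrow>
     (\<forall>F. maximal_k_wise_intersecting n 3 F \<and>
          real (card F) \<le> 2 powr ((real n + 2) / 2) - 3 \<longrightarrow>
          balanced_linked_cubes n F)"
proof -
  obtain k0 where k0: "\<And>k. k \<ge> k0 \<Longrightarrow> 2 * (14400000000 * (real k)\<^sup>2) ^ 18 \<le> 2 ^ (k div 8)"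
    using exists_large_threshold by blast
  have main: "balanced_linked_cubes (2 * k) F"
    if k: "k \<ge> k0" "k \<ge> 128" and F: "maximal_k_wise_intersecting (2 * k) 3 F"
      and card: "real (card F) \<le> 2 powr ((real (2 * k) + 2) / 2) - 3" for k F
  proof -
    let ?V = "ground (2 * k)"
    have "(real (2 * k) + 2) / 2 = real (k + 1)" by simp
    then have "real (card F + 3) \<le> real (2 * 2 ^ k)"
      using card by (simp only: powr_realpow) (simp add: powr_realpow)
    then have cF: "card F + 3 \<le> 2 * 2 ^ k" by (simp only: of_nat_le_iff)
    interpret generating_downset ?V "(\<lambda>X. ?V - X) ` F" k
      using generating_downset_complements[OF F cF] k by simp
    obtain S where S: "S \<subseteq> ?V" "card S = k" "20 * card (Pow S - (\<lambda>X. ?V - X) ` F) \<le> 2 ^ k"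
      "20 * card (Pow (?V - S) - (\<lambda>X. ?V - X) ` F) \<le> 2 ^ k"
      \<comment> \<open>The bound \<open>k >= 128\<close> serves to make \<open>k div 8\<close> at
        least 16.\<close>
      by (rule almost_cubes[of "k div 8"]) (use k k0 in auto)
    have eq: "(\<lambda>X. ?V - X) ` F = {A. A \<subset> S} \<union> {B. B \<subset> ?V - S}"
      using eq_of_almost_cubes[OF S(1,2) _ S(3,4)] k by simp
    have FV: "F \<subseteq> Pow ?V" using F by (simp add: maximal_k_wise_intersecting_def)
    have "X \<in> F \<longleftrightarrow> X \<in> linked_cubes (2 * k) S" for X
    proof (cases "X \<subseteq> ?V")
      case True
      have "X \<in> F \<longleftrightarrow> ?V - X \<in> (\<lambda>X. ?V - X) ` F"
        using FV True by (auto simp: image_iff) (metis Pow_iff double_diff subset_refl subsetD)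
      also have "\<dots> \<longleftrightarrow> X \<in> linked_cubes (2 * k) S"
        unfolding eq linked_cubes_def using True S(1) by blast
      finally show ?thesis .
    next
      case False
      then show ?thesis using FV by (auto simp: linked_cubes_def)
    qed
    \<comment> \<open>For \<open>n = 2 * k\<close> both bounds in the balance condition equal
      \<open>k\<close>.\<close>
    then show ?thesis using S(1,2) unfolding balanced_linked_cubes_def by auto
  qed
  have "balanced_linked_cubes n F"
    if "even n" "n \<ge> 2 * (k0 + 128)" "maximal_k_wise_intersecting n 3 F"
      "real (card F) \<le> 2 powr ((real n + 2) / 2) - 3" for n F
  proof -
    obtain k where "n = 2 * k" using \<open>even n\<close> by blast
    then show ?thesis using main[of k F] that by simp
  qed
  then show ?thesis by blast
qed

end
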